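(* Let $m$ be an odd positive integer, $r$ an integer, and $q,s$ complex numbers. Put $$P_k=\prod_{j=0}^{2m-1}w_{k+r+j},\qquad Q_k=\prod_{j=0}^{m-1}w_{k+r+j}\prod_{j=m+1}^{2m}w_{k+r+j}\qquad(k\ge1),$$ and assume $w_{k+r}\ne0$ for all $k\ge1$. Each identity below is asserted whenever the binomial coefficients in it are defined, both of its series converge, and, writing its right-hand side as $v_m\sum_{k\ge1}Y_k/Q_k$, one has $\lim_{n\to\infty}Y_n/P_{n+1}=0$. (a) $$\sum_{k = 1}^\infty \frac{\binom{k + q}{s}}{P_k} = v_m \sum_{k = 1}^\infty \frac{\binom{k + q + 1}{s + 1} - \binom{q + 1}{s + 1}}{Q_k}.$$ (b) $$\sum_{k = 1}^\infty \frac{( - 1)^{k - 1} \binom{q}{k + s}}{P_k} = v_m \sum_{k = 1}^\infty \frac{( - 1)^{k - 1} \binom{q - 1}{k + s} + \binom{q - 1}{s}}{Q_k}.$$ In particular: (c) $$\sum_{k = 1}^\infty \frac{2^{2k}}{\binom{2k}{k}P_k} = \frac{2v_m}{3} \sum_{k = 1}^\infty \frac{2^{2k} - C_k}{C_k\, Q_k}.$$ (d) $$\sum_{k = 1}^\infty \frac{\binom{2k}{k}}{2^{2k} P_k} = v_m \sum_{k = 1}^\infty \frac{(k+1)( 2k + 1 )2^{-2k}C_k - 1}{Q_k} .$$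
   Context: Let $a,b,p$ be complex numbers. The sequence $(w_n)$ is defined by $w_0=a$, $w_1=b$, $w_n=p\,w_{n-1}+w_{n-2}$, extended to negative indices by the same recurrence ($w_n=w_{n+2}-p\,w_{n+1}$). The companion sequence is $v_0=2$, $v_1=p$, $v_n=p\,v_{n-1}+v_{n-2}$ for $n\ge2$. For complex $x,y$ with $x$ not a negative integer, $\binom{x}{y}=\frac{\Gamma(x+1)}{\Gamma(y+1)\Gamma(x-y+1)}$, where $1/\Gamma$ is the entire function vanishing at $0,-1,-2,\dots$; the binomial coefficient is regarded as defined exactly when $x$ is not a negative integer. $C_k=\frac{1}{k+1}\binom{2k}{k}$ are the Catalan numbers. *)

theory Defs
  imports "HOL-Analysis.Analysis"
begin

function horadam :: "complex \<Rightarrow> complex \<Rightarrow> complex \<Rightarrow> int \<Rightarrow> complex" where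
  "horadam a b p n =
     (if n = 0 then a
      else if n = 1 then b
      else if n \<ge> 2 then p * horadam a b p (n - 1) + horadam a b p (n - 2)
      else horadam a b p (n + 2) - p * horadam a b p (n + 1))"
  by pat_completeness auto
termination
  by (relation "Wellfounded.measure (\<lambda>(a, b, p, n). nat \<bar>2 * n - 1\<bar>)") auto

declare horadam.simps [simp del]

lemma horadam_0: "horadam a b p 0 = a"
  and horadam_1: "horadam a b p 1 = b"
  by (simp_all add: horadam.simps)

lemma horadam_rec: "horadam a b p n = p * horadam a b p (n - 1) + horadam a b p (n - 2)"
proof (cases "n \<ge> 2")
  case True
  then show ?thesis by (subst horadam.simps) simp
next
  case False
  then have "horadam a b p (n - 2) = horadam a b p n - p * horadam a b p (n - 1)"
    by (subst horadam.simps) simp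
  then show ?thesis by simp
qed

fun companion :: "complex \<Rightarrow> nat \<Rightarrow> complex" where
  "companion p 0 = 2"
| "companion p (Suc 0) = p"
| "companion p (Suc (Suc n)) = p * companion p (Suc n) + companion p n"

text \<open>The lower argument is an arbitrary complex number, which \<open>gchoose\<close> does not allow.
  The value is meaningful only under \<open>cbinom_defined x\<close>; elsewhere the library's
  convention that \<open>Gamma\<close> vanishes at its poles makes it \<open>0\<close>.\<close>

definition cbinom :: "complex \<Rightarrow> complex \<Rightarrow> complex" where
  "cbinom x y = Gamma (x + 1) * rGamma (y + 1) * rGamma (x - y + 1)"

definition cbinom_defined :: "complex \<Rightarrow> bool" where
  "cbinom_defined x \<longleftrightarrow> (\<forall>n::int. n < 0 \<longrightarrow> x \<noteq> of_int n)"

lemma cbinom_of_nat: "cbinom (of_nat n) (of_nat k) = of_nat (n choose k)"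
proof (cases "k \<le> n")
  case True
  have "cbinom (of_nat n) (of_nat k) = fact n / (fact k * fact (n - k))"
    using True Gamma_fact[of n, where 'a = complex] Gamma_fact[of k, where 'a = complex]
      Gamma_fact[of "n - k", where 'a = complex]
    by (simp add: cbinom_def rGamma_inverse_Gamma of_nat_diff add.commute divide_simps)
  then show ?thesis using True by (simp add: binomial_fact)
next
  case False
  have "of_nat n - of_nat k + 1 = (- of_nat (k - n - 1) :: complex)"
    using False by (simp add: of_nat_diff)
  then have "rGamma (of_nat n - of_nat k + 1 :: complex) = 0"
    by (simp add: rGamma_eq_zero_iff)
  then show ?thesis using False by (simp add: cbinom_def)
qed

definition catalan :: "nat \<Rightarrow> complex" where
  "catalan k = of_nat ((2 * k) choose k) / (of_nat k + 1)"

definition prodP :: "(int \<Rightarrow> complex) \<Rightarrow> nat \<Rightarrow> int \<Rightarrow> nat \<Rightarrow> complex" where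
  "prodP w m r k = (\<Prod>j<2 * m. w (int k + r + int j))"

definition prodQ :: "(int \<Rightarrow> complex) \<Rightarrow> nat \<Rightarrow> int \<Rightarrow> nat \<Rightarrow> complex" where
  "prodQ w m r k =
     (\<Prod>j<m. w (int k + r + int j)) * (\<Prod>j = m + 1..2 * m. w (int k + r + int j))"

text \<open>Series indexed by \<open>k \<ge> 1\<close>, with (possibly conditional) convergence of partial sums.\<close>

definition summable1 :: "(nat \<Rightarrow> complex) \<Rightarrow> bool" where
  "summable1 f \<longleftrightarrow> summable (\<lambda>k. f (Suc k))"

definition series1 :: "(nat \<Rightarrow> complex) \<Rightarrow> complex" where
  "series1 f = (\<Sum>k. f (Suc k))"

end

theory Submission
  imports Defs
begin

text \<open>All four identities are summation by parts against one telescoping relation.  The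
  characteristic roots of the recurrence have product \<open>-1\<close>, so
  \<open>w (n + m) + (-1) ^ m * w (n - m) = v m * w n\<close>, which for odd \<open>m\<close> reads
  \<open>w (n + 2 * m) - w n = v m * w (n + m)\<close>.  The products \<open>P k\<close> and \<open>P (k + 1)\<close>
  share all factors but the first of the one and the last of the other, and \<open>Q k\<close> is the
  product of their combined \<open>2 * m + 1\<close> factors with the middle one left out.  Hence
  \<open>1 / P k - 1 / P (k + 1) = v m / Q k\<close> (\<open>inverse_prodP_telescope\<close>).

  If \<open>Y k\<close> is the partial sum \<open>X 1 + \<dots> + X k\<close>, Abel summation turns the partial sums of
  \<open>X k / P k\<close> into those of \<open>v m * Y k / Q k\<close> plus the boundary term
  \<open>Y n / P (n + 1)\<close>, which is assumed to vanish in the limit (\<open>series1_by_parts\<close>).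
  What distinguishes the four parts is only the closed form of \<open>Y\<close>: Pascal's rule for complex
  arguments sums the binomial coefficients of the first two, and the recurrence of the central
  binomial coefficients sums those of the last two.\<close>

lemma horadam_add_shift:
  "horadam a b p (n + int m) + (-1) ^ m * horadam a b p (n - int m)
     = companion p m * horadam a b p n"
proof (induction p m rule: companion.induct)
  case (1 p)
  then show ?case by simp
next
  case (2 p)
  show ?case
    using horadam_rec[of a b p "n + 1"] by simp
next
  case (3 p m)
  have up: "horadam a b p (n + int (Suc (Suc m)))
      = p * horadam a b p (n + int (Suc m)) + horadam a b p (n + int m)"
    using horadam_rec[of a b p "n + int (Suc (Suc m))"] by (simp add: algebra_simps)
  have down: "horadam a b p (n - int m)
      = p * horadam a b p (n - int (Suc m)) + horadam a b p (n - int (Suc (Suc m)))"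
    using horadam_rec[of a b p "n - int m"] by (simp add: algebra_simps)
  have "companion p (Suc (Suc m)) * horadam a b p n
      = p * (companion p (Suc m) * horadam a b p n) + companion p m * horadam a b p n"
    by (simp add: algebra_simps)
  also have "\<dots> = p * (horadam a b p (n + int (Suc m))
        + (-1) ^ Suc m * horadam a b p (n - int (Suc m)))
      + (horadam a b p (n + int m) + (-1) ^ m * horadam a b p (n - int m))"
    by (simp only: 3)
  also have "\<dots> = horadam a b p (n + int (Suc (Suc m)))
      + (-1) ^ Suc (Suc m) * horadam a b p (n - int (Suc (Suc m)))"
    unfolding up down by (simp add: algebra_simps)
  finally show ?case ..
qed

lemma inverse_prodP_telescope:
  assumes "odd m" and nz: "\<And>k::nat. k \<ge> 1 \<Longrightarrow> horadam a b p (int k + r) \<noteq> 0"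
    and k: "k \<ge> 1"
  defines "w \<equiv> horadam a b p"
  shows "1 / prodP w m r k - 1 / prodP w m r (Suc k) = companion p m / prodQ w m r k"
proof -
  define u where "u j = w (int k + r + int j)" for j
  have u0: "u j \<noteq> 0" for j
    using nz[of "k + j"] k by (simp add: u_def w_def algebra_simps)
  \<comment> \<open>the factors that \<open>P k\<close> and \<open>P (k + 1)\<close> have in common\<close>
  define R where "R = (\<Prod>j = 1..<2 * m. u j)"
  have m0: "m > 0" using \<open>odd m\<close> by (auto intro: odd_pos)
  have "prodP w m r k = prod u {0..<2 * m}"
    by (simp add: prodP_def u_def atLeast0LessThan)
  also have "\<dots> = u 0 * R"
    using m0 by (simp add: R_def prod.atLeast_Suc_lessThan)
  finally have Pk: "prodP w m r k = u 0 * R" .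
  have "prodP w m r (Suc k) = (\<Prod>j<2 * m. u (Suc j))"
    by (simp add: prodP_def u_def algebra_simps)
  also have "\<dots> = prod u {Suc 0..<Suc (2 * m)}"
    by (simp only: prod.atLeast_Suc_lessThan_Suc_shift atLeast0LessThan o_def)
  also have "\<dots> = R * u (2 * m)"
    using m0 by (simp add: R_def)
  finally have PSk: "prodP w m r (Suc k) = R * u (2 * m)" .
  have "prodQ w m r k * u m = (prod u {0..<m} * u m) * prod u {Suc m..<Suc (2 * m)}"
    by (simp add: prodQ_def u_def atLeast0LessThan atLeastLessThanSuc_atLeastAtMost)
  also have "\<dots> = prod u {0..<Suc m} * prod u {Suc m..<Suc (2 * m)}"
    by simp
  also have "\<dots> = prod u {0..<Suc (2 * m)}"
    by (intro prod.atLeastLessThan_concat) auto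
  also have "\<dots> = u 0 * R * u (2 * m)"
    using m0 by (simp add: R_def prod.atLeast_Suc_lessThan)
  finally have Qk: "prodQ w m r k * u m = u 0 * R * u (2 * m)" .
  have "w ((int k + r + int m) + int m) - w ((int k + r + int m) - int m)
      = companion p m * w (int k + r + int m)"
    using horadam_add_shift[of a b p "int k + r + int m" m] \<open>odd m\<close> by (simp add: w_def)
  then have diff: "u (2 * m) - u 0 = companion p m * u m"
    by (simp add: u_def algebra_simps)
  have R0: "R \<noteq> 0" using u0 by (simp add: R_def)
  have "prodQ w m r k = u 0 * R * u (2 * m) / u m"
    using Qk u0[of m] by (simp add: field_simps)
  then have "companion p m / prodQ w m r k = (companion p m * u m) / (u 0 * R * u (2 * m))"
    using u0 by simp
  also have "\<dots> = 1 / prodP w m r k - 1 / prodP w m r (Suc k)"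
    unfolding diff[symmetric] Pk PSk using u0[of 0] u0[of "2 * m"] R0 by (simp add: field_simps)
  finally show ?thesis ..
qed

text \<open>Abel summation.  The condition \<open>Y 1 = X 1\<close> takes the place of \<open>Y 0 = 0\<close>: the closed
  forms to which this is applied need not have their natural value at index \<open>0\<close>, where
  truncated subtraction turns \<open>(-1) ^ (0 - 1)\<close> into \<open>1\<close>.\<close>

lemma series1_by_parts:
  assumes tel: "\<And>k. k \<ge> 1 \<Longrightarrow> 1 / P k - 1 / P (Suc k) = c / Q k"
    and Y1: "Y 1 = X 1" and YSuc: "\<And>k. k \<ge> 1 \<Longrightarrow> Y (Suc k) = Y k + X (Suc k)"
    and summable: "summable1 (\<lambda>k. Y k / Q k)"
    and lim: "(\<lambda>n. Y n / P (n + 1)) \<longlonglongrightarrow> 0"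
  shows "series1 (\<lambda>k. X k / P k) = c * series1 (\<lambda>k. Y k / Q k)"
proof -
  have tel': "Y k / P k - Y k / P (Suc k) = c * (Y k / Q k)" if "k \<ge> 1" for k
    using arg_cong[OF tel[OF that], of "\<lambda>x. Y k * x"] by (simp add: right_diff_distrib)
  have partial: "(\<Sum>k<Suc n. X (Suc k) / P (Suc k))
      = Y (Suc n) / P (Suc n + 1) + c * (\<Sum>k<Suc n. Y (Suc k) / Q (Suc k))" for n
  proof (induction n)
    case 0
    show ?case using tel'[of 1] Y1 by (simp add: algebra_simps)
  next
    case (Suc n)
    have step: "X (Suc (Suc n)) = Y (Suc (Suc n)) - Y (Suc n)" using YSuc[of "Suc n"] by simp
    have "(\<Sum>k<Suc (Suc n). X (Suc k) / P (Suc k))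
        = Y (Suc n) / P (Suc n + 1) + c * (\<Sum>k<Suc n. Y (Suc k) / Q (Suc k))
          + X (Suc (Suc n)) / P (Suc (Suc n))"
      by (subst sum.lessThan_Suc) (simp only: Suc)
    also have "\<dots> = c * (\<Sum>k<Suc n. Y (Suc k) / Q (Suc k)) + Y (Suc (Suc n)) / P (Suc (Suc n))"
      by (simp add: step diff_divide_distrib)
    also have "Y (Suc (Suc n)) / P (Suc (Suc n))
        = Y (Suc (Suc n)) / P (Suc (Suc n) + 1) + c * (Y (Suc (Suc n)) / Q (Suc (Suc n)))"
      using tel'[of "Suc (Suc n)"] by (simp add: algebra_simps)
    finally show ?case
      by (subst (2) sum.lessThan_Suc) (simp only: distrib_left add_ac)
  qed
  have Q_sums: "(\<lambda>n. \<Sum>k<Suc n. Y (Suc k) / Q (Suc k)) \<longlonglongrightarrow> series1 (\<lambda>k. Y k / Q k)"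
    using summable_LIMSEQ summable unfolding summable1_def series1_def
    by (intro LIMSEQ_Suc) blast
  have "(\<lambda>n. Y (Suc n) / P (Suc n + 1) + c * (\<Sum>k<Suc n. Y (Suc k) / Q (Suc k)))
      \<longlonglongrightarrow> 0 + c * series1 (\<lambda>k. Y k / Q k)"
    using LIMSEQ_Suc[OF lim] Q_sums by (intro tendsto_intros)
  then have "(\<lambda>n. \<Sum>k<Suc n. X (Suc k) / P (Suc k)) \<longlonglongrightarrow> c * series1 (\<lambda>k. Y k / Q k)"
    by (simp only: partial add_0_left)
  then have "(\<lambda>k. X (Suc k) / P (Suc k)) sums (c * series1 (\<lambda>k. Y k / Q k))"
    unfolding sums_def by (rule LIMSEQ_imp_Suc)
  then show ?thesis
    unfolding series1_def by (simp add: sums_iff)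
qed

text \<open>All three coefficients are multiples of
  \<open>Gamma (x + 1) * rGamma (y + 2) * rGamma (x - y + 1)\<close>, and the rule says
  \<open>x + 1 = (x - y) + (y + 1)\<close>.\<close>

lemma cbinom_pascal:
  assumes "cbinom_defined x"
  shows "cbinom (x + 1) (y + 1) = cbinom x (y + 1) + cbinom x y"
proof -
  have "x + 1 \<notin> \<int>\<^sub>\<le>\<^sub>0"
  proof
    assume "x + 1 \<in> \<int>\<^sub>\<le>\<^sub>0"
    then obtain n where "n \<le> 0" "x + 1 = of_int n" by (auto elim: nonpos_Ints_cases)
    then have "x = of_int (n - 1)" "n - 1 < 0" by (auto simp: algebra_simps)
    then show False using assms unfolding cbinom_defined_def by blast
  qed
  then have G: "Gamma (x + 2) = (x + 1) * Gamma (x + 1)"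
    using Gamma_plus1[of "x + 1"] by (simp add: add.assoc)
  have r1: "rGamma (y + 1) = (y + 1) * rGamma (y + 2)"
    using rGamma_plus1[of "y + 1"] by (simp add: add.commute add.left_commute)
  have r2: "rGamma (x - y) = (x - y) * rGamma (x - y + 1)"
    using rGamma_plus1[of "x - y"] by simp
  have "cbinom (x + 1) (y + 1) = Gamma (x + 2) * rGamma (y + 2) * rGamma (x - y + 1)"
    by (simp add: cbinom_def algebra_simps)
  moreover have "cbinom x (y + 1) = Gamma (x + 1) * rGamma (y + 2) * rGamma (x - y)"
    by (simp add: cbinom_def algebra_simps)
  moreover have "cbinom x y = Gamma (x + 1) * rGamma (y + 1) * rGamma (x - y + 1)"
    by (simp add: cbinom_def)
  ultimately show ?thesis
    unfolding G r1 r2 by (simp add: algebra_simps)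
qed

lemma central_binomial_Suc:
  "of_nat (Suc k) * of_nat ((2 * Suc k) choose Suc k)
     = (2 * (2 * of_nat k + 1) * of_nat ((2 * k) choose k) :: complex)"
proof -
  have 1: "Suc k * ((2 * Suc k) choose Suc k) = (2 * Suc k) * (Suc (2 * k) choose k)"
    using Suc_times_binomial_eq[of "Suc (2 * k)" k] by (simp add: mult.commute)
  have 2: "Suc k * (Suc (2 * k) choose k) = Suc (2 * k) * ((2 * k) choose k)"
    using Suc_times_binomial_eq[of "2 * k" k] binomial_symmetric[of k "Suc (2 * k)"]
    by (simp add: mult.commute Suc_diff_le)
  have "Suc k * (Suc k * ((2 * Suc k) choose Suc k)) = Suc k * (2 * (2 * k + 1) * ((2 * k) choose k))"
    using 1 2 by (metis Suc_eq_plus1 mult.assoc mult.left_commute)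
  then have "Suc k * ((2 * Suc k) choose Suc k) = 2 * (2 * k + 1) * ((2 * k) choose k)"
    by (simp only: mult_cancel1) simp
  then have "of_nat (Suc k * ((2 * Suc k) choose Suc k))
      = (of_nat (2 * (2 * k + 1) * ((2 * k) choose k)) :: complex)"
    by (simp only:)
  then show ?thesis by (simp only: of_nat_mult of_nat_add of_nat_numeral of_nat_1)
qed

theorem proposition6:
  fixes a b p q s :: complex and r :: int and m :: nat
    and w :: "int \<Rightarrow> complex" and P Q :: "nat \<Rightarrow> complex"
  assumes w: "w = horadam a b p"
    and P: "P = prodP w m r"
    and Q: "Q = prodQ w m r"
    and "odd m"
    and "\<forall>k::nat. k \<ge> 1 \<longrightarrow> w (int k + r) \<noteq> 0"
  shows
   "((\<forall>k::nat. k \<ge> 1 \<longrightarrow> cbinom_defined (of_nat k + q) \<and> cbinom_defined (of_nat k + q + 1))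
       \<and> cbinom_defined (q + 1)
       \<and> summable1 (\<lambda>k. cbinom (of_nat k + q) s / P k)
       \<and> summable1 (\<lambda>k. (cbinom (of_nat k + q + 1) (s + 1) - cbinom (q + 1) (s + 1)) / Q k)
       \<and> (\<lambda>n. (cbinom (of_nat n + q + 1) (s + 1) - cbinom (q + 1) (s + 1)) / P (n + 1)) \<longlonglongrightarrow> 0
     \<longrightarrow> series1 (\<lambda>k. cbinom (of_nat k + q) s / P k)
         = companion p m
           * series1 (\<lambda>k. (cbinom (of_nat k + q + 1) (s + 1) - cbinom (q + 1) (s + 1)) / Q k))
    \<and>
    (cbinom_defined q \<and> cbinom_defined (q - 1)
       \<and> summable1 (\<lambda>k. (-1) ^ (k - 1) * cbinom q (of_nat k + s) / P k)
       \<and> summable1 (\<lambda>k. ((-1) ^ (k - 1) * cbinom (q - 1) (of_nat k + s) + cbinom (q - 1) s) / Q k)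
       \<and> (\<lambda>n. ((-1) ^ (n - 1) * cbinom (q - 1) (of_nat n + s) + cbinom (q - 1) s) / P (n + 1))
           \<longlonglongrightarrow> 0
     \<longrightarrow> series1 (\<lambda>k. (-1) ^ (k - 1) * cbinom q (of_nat k + s) / P k)
         = companion p m
           * series1 (\<lambda>k. ((-1) ^ (k - 1) * cbinom (q - 1) (of_nat k + s) + cbinom (q - 1) s) / Q k))
    \<and>
    (summable1 (\<lambda>k. 2 ^ (2 * k) / (of_nat ((2 * k) choose k) * P k))
       \<and> summable1 (\<lambda>k. (2 ^ (2 * k) - catalan k) / (catalan k * Q k))
       \<and> (\<lambda>n. (2 / 3 * ((2 ^ (2 * n) - catalan n) / catalan n)) / P (n + 1)) \<longlonglongrightarrow> 0
     \<longrightarrow> series1 (\<lambda>k. 2 ^ (2 * k) / (of_nat ((2 * k) choose k) * P k))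
         = 2 * companion p m / 3
           * series1 (\<lambda>k. (2 ^ (2 * k) - catalan k) / (catalan k * Q k)))
    \<and>
    (summable1 (\<lambda>k. of_nat ((2 * k) choose k) / (2 ^ (2 * k) * P k))
       \<and> summable1 (\<lambda>k. ((of_nat k + 1) * (2 * of_nat k + 1) * 2 powi (- 2 * int k) * catalan k - 1)
                          / Q k)
       \<and> (\<lambda>n. ((of_nat n + 1) * (2 * of_nat n + 1) * 2 powi (- 2 * int n) * catalan n - 1)
                / P (n + 1)) \<longlonglongrightarrow> 0
     \<longrightarrow> series1 (\<lambda>k. of_nat ((2 * k) choose k) / (2 ^ (2 * k) * P k))
         = companion p m
           * series1 (\<lambda>k. ((of_nat k + 1) * (2 * of_nat k + 1) * 2 powi (- 2 * int k) * catalan k - 1)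
                            / Q k))"
proof -
  have tel: "1 / P k - 1 / P (Suc k) = companion p m / Q k" if "k \<ge> 1" for k
    using inverse_prodP_telescope[of m a b p r k] assms that by simp
  note parts = series1_by_parts[where P = P and Q = Q and c = "companion p m", OF tel]
  have odd_nz: "2 * of_nat k + 1 \<noteq> (0::complex)" for k :: nat
  proof -
    have "2 * of_nat k + 1 = (of_nat (2 * k + 1) :: complex)" by simp
    then show ?thesis by (simp only: of_nat_eq_0_iff)
  qed
  define B :: "nat \<Rightarrow> complex" where "B k = of_nat ((2 * k) choose k)" for k
  have B_nz: "B k \<noteq> 0" for k by (simp add: B_def)
  have B1: "B (Suc 0) = 2" by (simp add: B_def)
  have k1_nz: "of_nat k + 1 \<noteq> (0::complex)" for k :: nat
    using of_nat_neq_0[of k, where 'a = complex] by (simp add: add.commute)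
  have B_Suc: "B (Suc k) = 2 * (2 * of_nat k + 1) * B k / (of_nat k + 1)" for k
  proof -
    have "of_nat (Suc k) * B (Suc k) = 2 * (2 * of_nat k + 1) * B k"
      by (simp only: B_def central_binomial_Suc)
    then show ?thesis
      using k1_nz[of k] by (simp add: field_simps)
  qed
  have catalan: "catalan k = B k / (of_nat k + 1)" for k
    by (simp add: catalan_def B_def)
  show ?thesis
  proof (intro conjI impI; elim conjE)
    assume defined: "\<forall>k::nat. k \<ge> 1 \<longrightarrow>
        cbinom_defined (of_nat k + q) \<and> cbinom_defined (of_nat k + q + 1)"
      and summable: "summable1 (\<lambda>k. (cbinom (of_nat k + q + 1) (s + 1) - cbinom (q + 1) (s + 1)) / Q k)"
      and lim: "(\<lambda>n. (cbinom (of_nat n + q + 1) (s + 1) - cbinom (q + 1) (s + 1)) / P (n + 1)) \<longlonglongrightarrow> 0"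
    have pascal: "cbinom (of_nat k + q + 1) (s + 1)
        = cbinom (of_nat k + q) (s + 1) + cbinom (of_nat k + q) s" if "k \<ge> 1" for k :: nat
      using defined that by (intro cbinom_pascal) auto
    show "series1 (\<lambda>k. cbinom (of_nat k + q) s / P k) = companion p m
        * series1 (\<lambda>k. (cbinom (of_nat k + q + 1) (s + 1) - cbinom (q + 1) (s + 1)) / Q k)"
    proof (rule parts[OF _ _ _ summable lim])
      show "cbinom (of_nat 1 + q + 1) (s + 1) - cbinom (q + 1) (s + 1) = cbinom (of_nat 1 + q) s"
        using pascal[of 1] by (simp add: add.commute)
      show "cbinom (of_nat (Suc k) + q + 1) (s + 1) - cbinom (q + 1) (s + 1)
          = cbinom (of_nat k + q + 1) (s + 1) - cbinom (q + 1) (s + 1) + cbinom (of_nat (Suc k) + q) s"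
        for k
        using pascal[of "Suc k"] by (simp add: add_ac)
    qed
  next
    assume defined: "cbinom_defined (q - 1)"
      and summable: "summable1 (\<lambda>k. ((-1) ^ (k - 1) * cbinom (q - 1) (of_nat k + s) + cbinom (q - 1) s) / Q k)"
      and lim: "(\<lambda>n. ((-1) ^ (n - 1) * cbinom (q - 1) (of_nat n + s) + cbinom (q - 1) s) / P (n + 1)) \<longlonglongrightarrow> 0"
    have pascal: "cbinom q (of_nat (Suc k) + s)
        = cbinom (q - 1) (of_nat (Suc k) + s) + cbinom (q - 1) (of_nat k + s)" for k :: nat
      using cbinom_pascal[OF defined, of "of_nat k + s"] by (simp add: add_ac)
    show "series1 (\<lambda>k. (-1) ^ (k - 1) * cbinom q (of_nat k + s) / P k) = companion p m
        * series1 (\<lambda>k. ((-1) ^ (k - 1) * cbinom (q - 1) (of_nat k + s) + cbinom (q - 1) s) / Q k)"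
    proof (rule parts[OF _ _ _ summable lim])
      show "(-1) ^ (1 - 1) * cbinom (q - 1) (of_nat 1 + s) + cbinom (q - 1) s
          = (-1) ^ (1 - 1) * cbinom q (of_nat 1 + s)"
        using pascal[of 0] by simp
      show "(-1) ^ (Suc k - 1) * cbinom (q - 1) (of_nat (Suc k) + s) + cbinom (q - 1) s
          = (-1) ^ (k - 1) * cbinom (q - 1) (of_nat k + s) + cbinom (q - 1) s
            + (-1) ^ (Suc k - 1) * cbinom q (of_nat (Suc k) + s)" if "k \<ge> 1" for k
      proof -
        have "(-1) ^ (Suc k - 1) = - ((-1) ^ (k - 1) :: complex)"
          using that by (cases k) auto
        then show ?thesis unfolding pascal by (simp add: algebra_simps)
      qed
    qed
  next
    assume summable: "summable1 (\<lambda>k. (2 ^ (2 * k) - catalan k) / (catalan k * Q k))"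
      and lim: "(\<lambda>n. (2 / 3 * ((2 ^ (2 * n) - catalan n) / catalan n)) / P (n + 1)) \<longlonglongrightarrow> 0"
    define X where "X k = 2 ^ (2 * k) / B k" for k
    define Z where "Z k = (2 ^ (2 * k) - catalan k) / catalan k" for k
    \<comment> \<open>The term ratio below makes \<open>(k + 1) X k\<close> equal to \<open>(k + 1/2) X (k + 1)\<close>, so
      \<open>(k + 1) X k\<close> increases by \<open>3/2 X (k + 1)\<close>: this is where the factor \<open>2/3\<close>
      comes from.\<close>
    have Z: "Z k = (of_nat k + 1) * X k - 1" for k
    proof -
      have "catalan k \<noteq> 0" using B_nz[of k] k1_nz[of k] by (simp add: catalan)
      then have "Z k = 2 ^ (2 * k) / catalan k - 1" by (simp add: Z_def diff_divide_distrib)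
      then show ?thesis by (simp add: catalan X_def mult.commute)
    qed
    have X_Suc: "(2 * of_nat k + 1) * X (Suc k) = 2 * (of_nat k + 1) * X k" for k
    proof -
      have "d * (4 * t / (2 * d * y / c)) = 2 * c * (t / y)" if "d \<noteq> 0" for c d t y :: complex
        using that by (simp add: field_simps)
      from this[OF odd_nz] show ?thesis by (simp add: X_def B_Suc)
    qed
    have summable': "summable1 (\<lambda>k. Z k / Q k)"
      using summable by (simp add: Z_def)
    have "summable1 (\<lambda>k. 2 / 3 * (Z k / Q k))"
      using summable' unfolding summable1_def by (rule summable_mult)
    then have "summable1 (\<lambda>k. 2 / 3 * Z k / Q k)" by simp
    moreover have "(\<lambda>n. 2 / 3 * Z n / P (n + 1)) \<longlonglongrightarrow> 0"
      using lim by (simp only: Z_def)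
    moreover have "2 / 3 * Z 1 = X 1"
      by (simp add: Z X_def B1)
    moreover have "2 / 3 * Z (Suc k) = 2 / 3 * Z k + X (Suc k)" for k
    proof -
      have "(of_nat k + 1) * X k = (2 * of_nat k + 1) * X (Suc k) / 2"
        using X_Suc[of k] by simp
      then show ?thesis unfolding Z by (simp add: field_simps)
    qed
    ultimately have "series1 (\<lambda>k. X k / P k) = companion p m * series1 (\<lambda>k. 2 / 3 * Z k / Q k)"
      by (intro parts) auto
    also have "series1 (\<lambda>k. 2 / 3 * Z k / Q k) = 2 / 3 * series1 (\<lambda>k. Z k / Q k)"
      using suminf_mult[of "\<lambda>k. Z (Suc k) / Q (Suc k)" "2 / 3"] summable'
      unfolding series1_def summable1_def by simp
    finally show "series1 (\<lambda>k. 2 ^ (2 * k) / (of_nat ((2 * k) choose k) * P k))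
        = 2 * companion p m / 3 * series1 (\<lambda>k. (2 ^ (2 * k) - catalan k) / (catalan k * Q k))"
      by (simp add: X_def Z_def B_def)
  next
    define X where "X k = B k / 2 ^ (2 * k)" for k
    \<comment> \<open>By the term ratio below, \<open>(2 k + 1) X k\<close> is \<open>(2 k + 2) X (k + 1)\<close>, which falls short
      of its successor \<open>(2 k + 3) X (k + 1)\<close> by exactly one term.\<close>
    define Y where "Y k = (2 * of_nat k + 1) * X k - 1" for k
    have Y: "(of_nat k + 1) * (2 * of_nat k + 1) * 2 powi (- 2 * int k) * catalan k - 1 = Y k" for k
    proof -
      have "(2::complex) powi (- 2 * int k) = inverse (2 ^ (2 * k))"
        by (metis mult_minus_left of_nat_mult of_nat_numeral power_int_minus power_int_of_nat)
      then show ?thesis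
        using k1_nz[of k] by (simp add: Y_def X_def catalan field_simps)
    qed
    have X_Suc: "2 * (of_nat k + 1) * X (Suc k) = (2 * of_nat k + 1) * X k" for k
    proof -
      have "2 * c * (2 * d * y / c / (4 * t)) = d * (y / t)" if "c \<noteq> 0" for c d t y :: complex
        using that by (simp add: field_simps)
      moreover have "X (Suc k) = 2 * (2 * of_nat k + 1) * B k / (of_nat k + 1) / (4 * 2 ^ (2 * k))"
        unfolding X_def B_Suc by simp
      ultimately show ?thesis
        unfolding X_def[of k] using k1_nz[of k] by metis
    qed
    assume "summable1 (\<lambda>k. ((of_nat k + 1) * (2 * of_nat k + 1) * 2 powi (- 2 * int k) * catalan k - 1) / Q k)"
      and "(\<lambda>n. ((of_nat n + 1) * (2 * of_nat n + 1) * 2 powi (- 2 * int n) * catalan n - 1) / P (n + 1)) \<longlonglongrightarrow> 0"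
    moreover have "Y 1 = X 1"
      by (simp add: Y_def X_def B1)
    moreover have "Y (Suc k) = Y k + X (Suc k)" for k
      using X_Suc[of k] by (simp add: Y_def algebra_simps)
    ultimately have "series1 (\<lambda>k. X k / P k) = companion p m * series1 (\<lambda>k. Y k / Q k)"
      unfolding Y by (intro parts) auto
    then show "series1 (\<lambda>k. of_nat ((2 * k) choose k) / (2 ^ (2 * k) * P k)) = companion p m
        * series1 (\<lambda>k. ((of_nat k + 1) * (2 * of_nat k + 1) * 2 powi (- 2 * int k) * catalan k - 1) / Q k)"
      unfolding Y by (simp add: X_def B_def)
  qed
qed

end
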